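(* Let $f_0,f_1$ be probability densities on $\mathbb{R}$ with $0<\mathbf{I}(f_1\|f_0)<\infty$ and $0<\mathbf{I}(f_0\|f_1)<\infty$. Let $a>0$, $a_1<a$ and $0<\epsilon_1\le 1$, and let $T_c(a)$ and $\Psi$ be the stopping time and the censoring policy of the CuSum-AC algorithm with parameters $a,a_1,\epsilon_1$. Then $T_c(a)$ is an equalizer rule for Lorden's detection delay $d_L$, i.e. $$d_{L}(T_c(a),\Psi) = \operatorname*{ess\,sup}_{\mathcal{I}_{\nu-1}} \mathbb{E}_{\nu}\big[(T_c(a)-\nu+1)^+\,\big|\,\mathcal{I}_{\nu-1}\big], \qquad \forall\, \nu\geq 1 .$$
   Context: Observation model. For $\nu\in\mathbb{N}_+=\{1,2,\dots\}$, under $\mathbb{P}_\nu$ the real random variables $X_1,X_2,\dots$ are independent, $X_1,\dots,X_{\nu-1}$ have density $f_0$ and $X_\nu,X_{\nu+1},\dots$ have density $f_1$; under $\mathbb{P}_\infty$ all $X_k$ have density $f_0$. $\mathbb{E}_\nu,\mathbb{E}_\infty$ are the expectations. $\mathbf{I}(f\|g)=\int_{\mathbb{R}} f\ln(f/g)\,dx$ is the Kullback–Leibler divergence, and $(x)^+=\max(0,x)$. Censoring strategies. A censoring strategy is a (measurable) map $\psi:\mathbb{R}\to\{0,1\}$; at time $k$ a strategy $\psi_k$ is used and $\gamma_k=\psi_k(X_k)$; $X_k$ is transmitted iff $\gamma_k=1$. A censoring policy $\Psi=(\psi_1,\psi_2,\dots)$ is such that $\psi_k$ is determined by $\mathcal{I}_{k-1}$,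 where $\mathcal{I}_k=\{(1,\gamma_1,\gamma_1X_1),\dots,(k,\gamma_k,\gamma_kX_k)\}$, $\mathcal{I}_0=\emptyset$. The log-likelihood ratio under strategy $\psi$ is $$\ell^{\psi}(\gamma,x)=\gamma\ln\frac{f_1(x)}{f_0(x)}+(1-\gamma)\ln\frac{\mathbb{P}_1\{\psi(X_1)=0\}}{\mathbb{P}_\infty\{\psi(X_1)=0\}},$$ and $\mathbf{I}^{\psi}(f_1\|f_0)=\mathbb{E}_1[\ell^{\psi}(\psi(X_1),X_1)]$. For $0<e\le 1$, $\psi^*(e)$ is a (fixed) maximizer of $\mathbf{I}^{\psi}(f_1\|f_0)$ over all $\psi$ with $\mathbb{P}_\infty\{\psi(X_1)=1\}=e$; $\psi^*(1)\equiv 1$ (everything is transmitted). CuSum-AC algorithm with parameters $a,a_1,\epsilon_1$. Put $s_0=0$ and for $k\ge 1$: $\psi_k=\psi^*(1)$ if $s_{k-1}\ge a_1$, and $\psi_k=\psi^*(\epsilon_1)$ if $s_{k-1}<a_1$; $\gamma_k=\psi_k(X_k)$; $\tilde s_k=\max\{0,s_{k-1}+\ell^{\psi_k}(\gamma_k,X_k)\}$; $s_k=a_1$ if $s_{k-1}<a_1$ and $\tilde s_k\ge a_1$, and $s_k=\tilde s_k$ otherwise. The censoring policy is $\Psi=(\psi_1,\psi_2,\dots)$ and the stopping time is $T_c(a)=\inf\{k\ge 1:s_k\ge a\}$. Lorden's (worst-worst case) detection delay of a pair $(T,\Psi)$, $T$ a stopping time with respect to $\sigma(\mathcal{I}_k)$,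 is $$d_L(T,\Psi)=\sup_{1\le\nu<\infty}\Big\{\operatorname*{ess\,sup}_{\mathcal{I}_{\nu-1}}\mathbb{E}_\nu[(T-\nu+1)^+\mid\mathcal{I}_{\nu-1}]\Big\}.$$ *)

theory Defs
  imports "HOL-Probability.Probability"
begin

definition prob_density :: "(real \<Rightarrow> real) \<Rightarrow> bool" where
  "prob_density f \<longleftrightarrow>
     f \<in> borel_measurable lborel \<and> (\<forall>x. 0 \<le> f x) \<and> (\<integral>\<^sup>+ x. ennreal (f x) \<partial>lborel) = 1"

(* The Kullback-Leibler divergence is extended-real valued: an infinite divergence must not
   collapse to the default value of a Bochner integral, as it would with KL_divergence.
   Conventions: 0 ln (0 / y) = 0, and y ln (y / 0) = \<infinity> for y > 0. *)
definition kl_integrand :: "(real \<Rightarrow> real) \<Rightarrow> (real \<Rightarrow> real) \<Rightarrow> real \<Rightarrow> ereal" where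
  "kl_integrand f g x =
     (if f x = 0 then 0 else if g x = 0 then \<infinity> else ereal (f x * ln (f x / g x)))"

(* Difference of the integrals of the positive and the negative part (e2ennreal is 0 on
   negative arguments). The second integral is at most 1 when f and g are densities,
   because f ln (f / g) \<ge> f - g, so the difference is never \<infinity> - \<infinity>. *)
definition kl_div :: "(real \<Rightarrow> real) \<Rightarrow> (real \<Rightarrow> real) \<Rightarrow> ereal" where
  "kl_div f g =
     enn2ereal (\<integral>\<^sup>+ x. e2ennreal (kl_integrand f g x) \<partial>lborel)
     - enn2ereal (\<integral>\<^sup>+ x. e2ennreal (- kl_integrand f g x) \<partial>lborel)"

(* P \<nu> is the law with change point \<nu>, where \<nu> \<ge> 1 or \<nu> = \<infinity> (no change). Observations
   are X 1, X 2, ...; the values P 0 and X 0 are unconstrained and unused. *)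
locale change_point_model =
  fixes P :: "enat \<Rightarrow> 'w measure" and X :: "nat \<Rightarrow> 'w \<Rightarrow> real"
    and f\<^sub>0 f\<^sub>1 :: "real \<Rightarrow> real"
  assumes prob_space_P: "1 \<le> \<nu> \<Longrightarrow> prob_space (P \<nu>)"
    and sets_P: "1 \<le> \<nu> \<Longrightarrow> sets (P \<nu>) = sets (P \<infinity>)"
    and indep_X: "1 \<le> \<nu> \<Longrightarrow> prob_space.indep_vars (P \<nu>) (\<lambda>_. borel) X {1..}"
    and distributed_X: "1 \<le> \<nu> \<Longrightarrow> 1 \<le> k \<Longrightarrow>
      distributed (P \<nu>) lborel (X k) (\<lambda>x. ennreal (if enat k < \<nu> then f\<^sub>0 x else f\<^sub>1 x))"

(* True stands for \<psi> x = 1 (transmit), False for \<psi> x = 0 (censor). *)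
type_synonym strategy = "real \<Rightarrow> bool"

definition llr :: "(enat \<Rightarrow> 'w measure) \<Rightarrow> (nat \<Rightarrow> 'w \<Rightarrow> real) \<Rightarrow> (real \<Rightarrow> real) \<Rightarrow> (real \<Rightarrow> real) \<Rightarrow>
    strategy \<Rightarrow> bool \<Rightarrow> real \<Rightarrow> real" where
  "llr P X f\<^sub>0 f\<^sub>1 \<psi> \<gamma> x =
     of_bool \<gamma> * ln (f\<^sub>1 x / f\<^sub>0 x)
     + (1 - of_bool \<gamma>) * ln (\<P>(\<omega> in P 1. \<not> \<psi> (X 1 \<omega>)) / \<P>(\<omega> in P \<infinity>. \<not> \<psi> (X 1 \<omega>)))"

definition censored_kl :: "(enat \<Rightarrow> 'w measure) \<Rightarrow> (nat \<Rightarrow> 'w \<Rightarrow> real) \<Rightarrow> (real \<Rightarrow> real) \<Rightarrow>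
    (real \<Rightarrow> real) \<Rightarrow> strategy \<Rightarrow> real" where
  "censored_kl P X f\<^sub>0 f\<^sub>1 \<psi> = (\<integral>\<omega>. llr P X f\<^sub>0 f\<^sub>1 \<psi> (\<psi> (X 1 \<omega>)) (X 1 \<omega>) \<partial>P 1)"

definition has_rate :: "(enat \<Rightarrow> 'w measure) \<Rightarrow> (nat \<Rightarrow> 'w \<Rightarrow> real) \<Rightarrow> real \<Rightarrow> strategy \<Rightarrow> bool" where
  "has_rate P X e \<psi> \<longleftrightarrow> Measurable.pred borel \<psi> \<and> \<P>(\<omega> in P \<infinity>. \<psi> (X 1 \<omega>)) = e"

definition optimal_strategies :: "(enat \<Rightarrow> 'w measure) \<Rightarrow> (nat \<Rightarrow> 'w \<Rightarrow> real) \<Rightarrow> (real \<Rightarrow> real) \<Rightarrow>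
    (real \<Rightarrow> real) \<Rightarrow> (real \<Rightarrow> strategy) \<Rightarrow> bool" where
  "optimal_strategies P X f\<^sub>0 f\<^sub>1 \<psi>s \<longleftrightarrow>
     (\<forall>e. 0 < e \<and> e \<le> 1 \<longrightarrow> is_arg_max (censored_kl P X f\<^sub>0 f\<^sub>1) (has_rate P X e) (\<psi>s e)) \<and>
     \<psi>s 1 = (\<lambda>_. True)"

(* A censoring policy is given by the strategies \<Psi> k \<omega> in force at times k \<ge> 1; through the
   past observations they depend on the sample point \<omega>. *)
type_synonym 'w policy = "nat \<Rightarrow> 'w \<Rightarrow> strategy"

definition transmitted :: "(nat \<Rightarrow> 'w \<Rightarrow> real) \<Rightarrow> 'w policy \<Rightarrow> nat \<Rightarrow> 'w \<Rightarrow> bool" where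
  "transmitted X \<Psi> k \<omega> = \<Psi> k \<omega> (X k \<omega>)"

definition info :: "(nat \<Rightarrow> 'w \<Rightarrow> real) \<Rightarrow> 'w policy \<Rightarrow> nat \<Rightarrow> 'w \<Rightarrow> nat \<Rightarrow> bool \<times> real" where
  "info X \<Psi> k \<omega> =
     (\<lambda>i\<in>{1..k}. (transmitted X \<Psi> i \<omega>, of_bool (transmitted X \<Psi> i \<omega>) * X i \<omega>))"

definition info_algebra :: "'w measure \<Rightarrow> (nat \<Rightarrow> 'w \<Rightarrow> real) \<Rightarrow> 'w policy \<Rightarrow> nat \<Rightarrow> 'w measure" where
  "info_algebra M X \<Psi> k =
     vimage_algebra (space M) (info X \<Psi> k) (PiM {1..k} (\<lambda>_. count_space UNIV \<Otimes>\<^sub>M borel))"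

(* The essential supremum over the information available before time \<nu> of the conditional
   mean delay. T is enat-valued because stopping may never occur. *)
definition worst_delay :: "(enat \<Rightarrow> 'w measure) \<Rightarrow> (nat \<Rightarrow> 'w \<Rightarrow> real) \<Rightarrow> ('w \<Rightarrow> enat) \<Rightarrow> 'w policy \<Rightarrow>
    nat \<Rightarrow> ennreal" where
  "worst_delay P X T \<Psi> \<nu> =
     esssup (P (enat \<nu>))
       (nn_cond_exp (P (enat \<nu>)) (info_algebra (P (enat \<nu>)) X \<Psi> (\<nu> - 1))
         (\<lambda>\<omega>. e2ennreal (max 0 (ereal_of_enat (T \<omega>) - ereal (real \<nu>) + 1))))"

definition lorden_delay :: "(enat \<Rightarrow> 'w measure) \<Rightarrow> (nat \<Rightarrow> 'w \<Rightarrow> real) \<Rightarrow> ('w \<Rightarrow> enat) \<Rightarrow> 'w policy \<Rightarrow>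
    ennreal" where
  "lorden_delay P X T \<Psi> = (SUP \<nu>\<in>{1..}. worst_delay P X T \<Psi> \<nu>)"

definition cusum_ac_strategy :: "(real \<Rightarrow> strategy) \<Rightarrow> real \<Rightarrow> real \<Rightarrow> real \<Rightarrow> strategy" where
  "cusum_ac_strategy \<psi>s a\<^sub>1 \<epsilon>\<^sub>1 s = (if s \<ge> a\<^sub>1 then \<psi>s 1 else \<psi>s \<epsilon>\<^sub>1)"

primrec cusum_ac_stat :: "(enat \<Rightarrow> 'w measure) \<Rightarrow> (nat \<Rightarrow> 'w \<Rightarrow> real) \<Rightarrow> (real \<Rightarrow> real) \<Rightarrow>
    (real \<Rightarrow> real) \<Rightarrow> (real \<Rightarrow> strategy) \<Rightarrow> real \<Rightarrow> real \<Rightarrow> nat \<Rightarrow> 'w \<Rightarrow> real" where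
  "cusum_ac_stat P X f\<^sub>0 f\<^sub>1 \<psi>s a\<^sub>1 \<epsilon>\<^sub>1 0 \<omega> = 0"
| "cusum_ac_stat P X f\<^sub>0 f\<^sub>1 \<psi>s a\<^sub>1 \<epsilon>\<^sub>1 (Suc k) \<omega> =
     (let s = cusum_ac_stat P X f\<^sub>0 f\<^sub>1 \<psi>s a\<^sub>1 \<epsilon>\<^sub>1 k \<omega>;
          \<psi> = cusum_ac_strategy \<psi>s a\<^sub>1 \<epsilon>\<^sub>1 s;
          x = X (Suc k) \<omega>;
          s' = max 0 (s + llr P X f\<^sub>0 f\<^sub>1 \<psi> (\<psi> x) x)
      in if s < a\<^sub>1 \<and> s' \<ge> a\<^sub>1 then a\<^sub>1 else s')"

definition cusum_ac_policy :: "(enat \<Rightarrow> 'w measure) \<Rightarrow> (nat \<Rightarrow> 'w \<Rightarrow> real) \<Rightarrow> (real \<Rightarrow> real) \<Rightarrow>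
    (real \<Rightarrow> real) \<Rightarrow> (real \<Rightarrow> strategy) \<Rightarrow> real \<Rightarrow> real \<Rightarrow> 'w policy" where
  "cusum_ac_policy P X f\<^sub>0 f\<^sub>1 \<psi>s a\<^sub>1 \<epsilon>\<^sub>1 k \<omega> =
     cusum_ac_strategy \<psi>s a\<^sub>1 \<epsilon>\<^sub>1 (cusum_ac_stat P X f\<^sub>0 f\<^sub>1 \<psi>s a\<^sub>1 \<epsilon>\<^sub>1 (k - 1) \<omega>)"

definition cusum_ac_time :: "(enat \<Rightarrow> 'w measure) \<Rightarrow> (nat \<Rightarrow> 'w \<Rightarrow> real) \<Rightarrow> (real \<Rightarrow> real) \<Rightarrow>
    (real \<Rightarrow> real) \<Rightarrow> (real \<Rightarrow> strategy) \<Rightarrow> real \<Rightarrow> real \<Rightarrow> real \<Rightarrow> 'w \<Rightarrow> enat" where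
  "cusum_ac_time P X f\<^sub>0 f\<^sub>1 \<psi>s a a\<^sub>1 \<epsilon>\<^sub>1 \<omega> =
     Inf {enat k | k. 1 \<le> k \<and> cusum_ac_stat P X f\<^sub>0 f\<^sub>1 \<psi>s a\<^sub>1 \<epsilon>\<^sub>1 k \<omega> \<ge> a}"

end

theory Submission
  imports Defs
begin

text \<open>Let \<open>G\<^sub>n s\<close> be the probability, under the post-change law, that the statistic started in
  \<open>s\<close> stays below \<open>a\<close> for \<open>n\<close> steps. Since the observations from \<open>\<nu>\<close> on are independent of the
  past, the conditional mean delay is \<open>\<Sum>n. G\<^sub>n s\<close> on \<open>{T \<ge> \<nu>}\<close>, where \<open>s\<close> is the statistic at
  time \<open>\<nu> - 1\<close>, and \<open>0\<close> elsewhere. Each \<open>G\<^sub>n\<close> is antitone and the statistic is nonnegative, so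
  this is at most \<open>\<Sum>n. G\<^sub>n 0\<close>. The bound is attained with positive probability: the
  log-likelihood ratio is nonpositive with positive probability under \<open>f\<^sub>0\<close>, so the statistic
  may sit at \<open>0\<close> until the change. Hence the worst-case delay does not depend on \<open>\<nu>\<close>.\<close>

section \<open>Driven recursions and their survival probabilities\<close>

text \<open>State and input types are left abstract because the recursion is run twice: on raw
  observations, which are independent, and on transmitted messages, which generate the information.
  Inputs start at index 1, like the observations.\<close>

primrec trajectory :: "('s \<Rightarrow> 'o \<Rightarrow> 's) \<Rightarrow> 's \<Rightarrow> (nat \<Rightarrow> 'o) \<Rightarrow> nat \<Rightarrow> 's" where
  "trajectory step s y 0 = s"
| "trajectory step s y (Suc k) = step (trajectory step s y k) (y (Suc k))"

lemma trajectory_cong: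
  assumes "\<And>i. 1 \<le> i \<Longrightarrow> i \<le> k \<Longrightarrow> y i = z i"
  shows "trajectory step s y k = trajectory step s z k"
  using assms by (induction k) auto

lemma measurable_trajectory:
  assumes [measurable]: "case_prod step \<in> measurable (S \<Otimes>\<^sub>M N) S"
    and s: "s \<in> space S" and "k \<le> m"
  shows "(\<lambda>y. trajectory step s y k) \<in> measurable (Pi\<^sub>M {1..m} (\<lambda>_. N)) S"
  using \<open>k \<le> m\<close>
proof (induction k)
  case 0
  show ?case using s by simp
next
  case (Suc k)
  then have [measurable]: "(\<lambda>y. trajectory step s y k) \<in> measurable (Pi\<^sub>M {1..m} (\<lambda>_. N)) S"
    and [measurable]: "(\<lambda>y. y (Suc k)) \<in> measurable (Pi\<^sub>M {1..m} (\<lambda>_. N)) N"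
    by (auto intro!: measurable_component_singleton)
  have "(\<lambda>y. case_prod step (trajectory step s y k, y (Suc k))) \<in> measurable (Pi\<^sub>M {1..m} (\<lambda>_. N)) S"
    by measurable
  then show ?case by simp
qed

primrec survival :: "'o measure \<Rightarrow> ('s \<Rightarrow> 'o \<Rightarrow> 's) \<Rightarrow> 's set \<Rightarrow> nat \<Rightarrow> 's \<Rightarrow> ennreal" where
  "survival Q step C 0 s = 1"
| "survival Q step C (Suc n) s =
     (\<integral>\<^sup>+ x. indicator C (step s x) * survival Q step C n (step s x) \<partial>Q)"

lemma measurable_survival:
  assumes Q: "sigma_finite_measure Q"
    and step[measurable]: "case_prod step \<in> measurable (S \<Otimes>\<^sub>M Q) S" and [measurable]: "C \<in> sets S"
  shows "survival Q step C n \<in> borel_measurable S"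
proof (induction n)
  case 0
  show ?case by (simp add: fun_eq_iff[symmetric] cong: measurable_cong)
next
  case (Suc n)
  interpret Q: sigma_finite_measure Q by fact
  note Suc[measurable]
  have "(\<lambda>p. indicator C (case_prod step p) * survival Q step C n (case_prod step p))
      \<in> borel_measurable (S \<Otimes>\<^sub>M Q)"
    by measurable
  then have "(\<lambda>s. \<integral>\<^sup>+ x. indicator C (step s x) * survival Q step C n (step s x) \<partial>Q) \<in> borel_measurable S"
    by (intro Q.borel_measurable_nn_integral) (simp add: case_prod_beta')
  then show ?case by simp
qed

lemma (in prob_space) survival_le_1: "survival M step C n s \<le> 1"
proof (induction n arbitrary: s)
  case (Suc n)
  have "survival M step C (Suc n) s \<le> (\<integral>\<^sup>+ x. 1 \<partial>M)"
    unfolding survival.simps by (intro nn_integral_mono) (auto simp: indicator_def Suc)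
  then show ?case by (simp add: emeasure_space_1)
qed simp

lemma (in prob_space) survival_Suc_le: "survival M step C (Suc n) s \<le> survival M step C n s"
proof (induction n arbitrary: s)
  case 0
  show ?case using survival_le_1[of step C "Suc 0" s] by simp
next
  case (Suc n)
  have "(\<integral>\<^sup>+ x. indicator C (step s x) * survival M step C (Suc n) (step s x) \<partial>M) \<le>
      (\<integral>\<^sup>+ x. indicator C (step s x) * survival M step C n (step s x) \<partial>M)"
    by (intro nn_integral_mono mult_left_mono Suc) auto
  then show ?case by (simp only: survival.simps(2))
qed

text \<open>The step may fail to be monotone across the threshold \<open>b\<close>, so trajectories cannot be
  compared pathwise. But a trajectory starting below \<open>b\<close> needs at least
  one step to reach \<open>b\<close>, which it cannot overshoot.\<close>

lemma (in prob_space) survival_antimono: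
  fixes step :: "real \<Rightarrow> 'a \<Rightarrow> real"
  assumes mono: "\<And>s t x. s \<le> t \<Longrightarrow> t < b \<or> b \<le> s \<Longrightarrow> step s x \<le> step t x"
    and below: "\<And>s x. s < b \<Longrightarrow> step s x \<le> b" and "b < a"
  shows "antimono (survival M step {..<a} n)"
proof (induction n)
  case 0
  show ?case by (auto simp: monotone_def)
next
  case (Suc n)
  have same: "survival M step {..<a} (Suc n) t \<le> survival M step {..<a} (Suc n) s"
    if "s \<le> t" "t < b \<or> b \<le> s" for s t
    unfolding survival.simps
    by (intro nn_integral_mono mult_mono antimonoD[OF Suc] mono that)
      (use mono[OF that] in \<open>auto simp: indicator_def dest: le_less_trans\<close>)
  show ?case
  proof (rule antimonoI)
    fix s t :: real assume "s \<le> t"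
    show "survival M step {..<a} (Suc n) t \<le> survival M step {..<a} (Suc n) s"
    proof (cases "s < b \<and> b \<le> t")
      case True
      have "survival M step {..<a} (Suc n) t \<le> survival M step {..<a} (Suc n) b"
        by (rule same) (use True in auto)
      \<comment> \<open>Giving up one step at \<open>b\<close> pays for the first step from
        \<open>s\<close>. That step ends at most at \<open>b\<close>, hence below \<open>a\<close>,
        so its indicator is 1 and \<open>n\<close> steps remain.\<close>
      also have "\<dots> \<le> survival M step {..<a} n b"
        by (rule survival_Suc_le)
      also have "\<dots> = (\<integral>\<^sup>+ x. survival M step {..<a} n b \<partial>M)"
        by (simp add: emeasure_space_1)
      also have "\<dots> \<le> survival M step {..<a} (Suc n) s"
        unfolding survival.simps
      proof (rule nn_integral_mono)
        fix x
        have "step s x \<le> b" using True below by blast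
        with antimonoD[OF Suc this] \<open>b < a\<close>
        show "survival M step {..<a} n b \<le> indicator {..<a} (step s x) * survival M step {..<a} n (step s x)"
          by (auto simp: indicator_def)
      qed
      finally show ?thesis .
    qed (use same \<open>s \<le> t\<close> in auto)
  qed
qed

section \<open>Integrating out future observations\<close>

text \<open>The first \<open>k\<close> observations and the next one have a product joint law, so
  Tonelli applies.\<close>

lemma (in prob_space) nn_integral_indep_next:
  assumes ind: "indep_vars (\<lambda>_. N) X {1::nat..}"
    and h[measurable]: "h \<in> borel_measurable (Pi\<^sub>M {1..k} (\<lambda>_. N) \<Otimes>\<^sub>M N)"
  shows "(\<integral>\<^sup>+ \<omega>. h (\<lambda>i\<in>{1..k}. X i \<omega>, X (Suc k) \<omega>) \<partial>M) =
    (\<integral>\<^sup>+ \<omega>. (\<integral>\<^sup>+ x. h (\<lambda>i\<in>{1..k}. X i \<omega>, x) \<partial>distr M N (X (Suc k))) \<partial>M)"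
proof -
  let ?S = "Pi\<^sub>M {1..k} (\<lambda>_. N)" and ?Z = "\<lambda>\<omega>. \<lambda>i\<in>{1..k}. X i \<omega>"
  have X[measurable]: "X i \<in> measurable M N" if "1 \<le> i" for i
    using ind that by (auto simp: indep_vars_def)
  \<comment> \<open>\<open>indep_var_restrict\<close> yields independence of blocks of coordinates,
    so the single next observation is packaged as a family over a one-element index set and
    projected out afterwards.\<close>
  let ?L = "Pi\<^sub>M {Suc k} (\<lambda>_. N)" and ?Y = "\<lambda>\<omega>. \<lambda>i\<in>{Suc k}. X i \<omega>"
  have "indep_var ?S ?Z ?L ?Y"
    by (rule indep_var_restrict[OF ind]) auto
  then have eq: "distr M ?S ?Z \<Otimes>\<^sub>M distr M ?L ?Y = distr M (?S \<Otimes>\<^sub>M ?L) (\<lambda>\<omega>. (?Z \<omega>, ?Y \<omega>))"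
    and Z[measurable]: "?Z \<in> measurable M ?S" and Y[measurable]: "?Y \<in> measurable M ?L"
    unfolding indep_var_distribution_eq by auto
  have [measurable]: "(\<lambda>y. y (Suc k)) \<in> measurable ?L N"
    by (rule measurable_component_singleton) simp
  interpret D: prob_space "distr M ?L ?Y"
    by (rule prob_space_distr) simp
  have "(\<integral>\<^sup>+ \<omega>. h (?Z \<omega>, X (Suc k) \<omega>) \<partial>M) =
      (\<integral>\<^sup>+ p. h (fst p, snd p (Suc k)) \<partial>(distr M ?S ?Z \<Otimes>\<^sub>M distr M ?L ?Y))"
    unfolding eq by (subst nn_integral_distr) (auto simp del: One_nat_def)
  also have "\<dots> = (\<integral>\<^sup>+ z. (\<integral>\<^sup>+ y. h (z, y (Suc k)) \<partial>distr M ?L ?Y) \<partial>distr M ?S ?Z)"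
    by (subst D.nn_integral_fst[symmetric]) (simp_all add: split_beta' del: One_nat_def)
  also have "\<dots> = (\<integral>\<^sup>+ z. (\<integral>\<^sup>+ x. h (z, x) \<partial>distr M N (X (Suc k))) \<partial>distr M ?S ?Z)"
    by (intro nn_integral_cong) (simp add: nn_integral_distr)
  also have "\<dots> = (\<integral>\<^sup>+ \<omega>. (\<integral>\<^sup>+ x. h (?Z \<omega>, x) \<partial>distr M N (X (Suc k))) \<partial>M)"
  proof -
    interpret E: prob_space "distr M N (X (Suc k))"
      by (rule prob_space_distr) simp
    show ?thesis by (subst nn_integral_distr) (auto simp del: One_nat_def)
  qed
  finally show ?thesis .
qed

text \<open>A Markov property in integrated form. The weight \<open>W\<close> is arbitrary so that
  the induction can absorb the constraint at time \<open>Suc k\<close> into it; the induction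
  hypothesis then applies from \<open>Suc k\<close> on, and integrating out \<open>X (Suc k)\<close>
  restores the recursion of \<open>survival\<close>.\<close>

lemma (in prob_space) nn_integral_survival:
  assumes ind: "indep_vars (\<lambda>_. N) X {1::nat..}"
    and Q: "\<And>j. k < j \<Longrightarrow> distr M N (X j) = Q"
    and step[measurable]: "case_prod step \<in> measurable (S \<Otimes>\<^sub>M N) S"
    and C[measurable]: "C \<in> sets S" and s: "s \<in> space S"
    and W: "W \<in> borel_measurable (Pi\<^sub>M {1..k} (\<lambda>_. N))"
  shows "(\<integral>\<^sup>+ \<omega>. W (\<lambda>i\<in>{1..k}. X i \<omega>) *
        of_bool (\<forall>i\<in>{k<..k + n}. trajectory step s (\<lambda>i. X i \<omega>) i \<in> C) \<partial>M) =
    (\<integral>\<^sup>+ \<omega>. W (\<lambda>i\<in>{1..k}. X i \<omega>) * survival Q step C n (trajectory step s (\<lambda>i. X i \<omega>) k) \<partial>M)"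
  using Q W
proof (induction n arbitrary: k W)
  case 0
  show ?case by simp
next
  case (Suc n)
  note W[measurable] = Suc.prems(2)
  let ?T = "\<lambda>\<omega>. trajectory step s (\<lambda>i. X i \<omega>)" and ?Z = "\<lambda>k \<omega>. \<lambda>i\<in>{1..k}. X i \<omega>"
  let ?W' = "\<lambda>z. W (restrict z {1..k}) * indicator C (trajectory step s z (Suc k))"
  have X[measurable]: "X i \<in> measurable M N" if "1 \<le> i" for i
    using ind that by (auto simp: indep_vars_def)
  have Qd: "Q = distr M N (X (Suc k))" using Suc.prems(1) by simp
  interpret Q: prob_space Q unfolding Qd by (rule prob_space_distr) simp
  have [measurable_cong]: "sets Q = sets N" by (simp add: Qd)
  have [measurable]: "survival Q step C n \<in> borel_measurable S"
    by (intro measurable_survival Q.sigma_finite_measure_axioms) measurable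
  have tr[measurable]: "(\<lambda>z. trajectory step s z j) \<in> measurable (Pi\<^sub>M {1..m} (\<lambda>_. N)) S" if "j \<le> m" for j m
    by (intro measurable_trajectory step s that)
  have traj: "trajectory step s (?Z m \<omega>) j = ?T \<omega> j" if "j \<le> m" for j m \<omega>
    using that by (intro trajectory_cong) auto
  have rs: "restrict (?Z (Suc k) \<omega>) {1..k} = ?Z k \<omega>" for \<omega>
    by (auto simp: restrict_def)
  have [measurable]: "(\<lambda>z. restrict z {1..k}) \<in> measurable (Pi\<^sub>M {1..Suc k} (\<lambda>_. N)) (Pi\<^sub>M {1..k} (\<lambda>_. N))"
    by (rule measurable_restrict_subset) auto
  have W': "?W' \<in> borel_measurable (Pi\<^sub>M {1..Suc k} (\<lambda>_. N))"
    by measurable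
  have "(\<integral>\<^sup>+ \<omega>. W (?Z k \<omega>) * of_bool (\<forall>i\<in>{k<..k + Suc n}. ?T \<omega> i \<in> C) \<partial>M) =
    (\<integral>\<^sup>+ \<omega>. ?W' (?Z (Suc k) \<omega>) * of_bool (\<forall>i\<in>{Suc k<..Suc k + n}. ?T \<omega> i \<in> C) \<partial>M)"
  proof (rule nn_integral_cong)
    fix \<omega>
    have "{k<..k + Suc n} = insert (Suc k) {Suc k<..Suc k + n}" by auto
    then show "W (?Z k \<omega>) * of_bool (\<forall>i\<in>{k<..k + Suc n}. ?T \<omega> i \<in> C) =
      ?W' (?Z (Suc k) \<omega>) * of_bool (\<forall>i\<in>{Suc k<..Suc k + n}. ?T \<omega> i \<in> C)"
      unfolding rs traj[OF order_refl] by (auto simp: indicator_def simp del: trajectory.simps)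
  qed
  also have "\<dots> = (\<integral>\<^sup>+ \<omega>. ?W' (?Z (Suc k) \<omega>) * survival Q step C n (?T \<omega> (Suc k)) \<partial>M)"
    by (rule Suc.IH[OF _ W']) (use Suc.prems(1) in auto)
  also have "\<dots> = (\<integral>\<^sup>+ \<omega>. (\<lambda>(z, x). W z * (indicator C (step (trajectory step s z k) x) *
      survival Q step C n (step (trajectory step s z k) x))) (?Z k \<omega>, X (Suc k) \<omega>) \<partial>M)"
    unfolding rs traj[OF order_refl] by (simp add: traj mult.assoc del: One_nat_def)
  also have "\<dots> = (\<integral>\<^sup>+ \<omega>. (\<integral>\<^sup>+ x. W (?Z k \<omega>) * (indicator C (step (?T \<omega> k) x) *
      survival Q step C n (step (?T \<omega> k) x)) \<partial>Q) \<partial>M)"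
  proof -
    let ?\<sigma> = "\<lambda>p. case_prod step (trajectory step s (fst p) k, snd p)"
    note measurable_compose[OF measurable_fst tr[OF order_refl], measurable]
    have [measurable]: "?\<sigma> \<in> measurable (Pi\<^sub>M {1..k} (\<lambda>_. N) \<Otimes>\<^sub>M N) S"
      by measurable
    have "(\<lambda>p. W (fst p) * (indicator C (?\<sigma> p) * survival Q step C n (?\<sigma> p)))
        \<in> borel_measurable (Pi\<^sub>M {1..k} (\<lambda>_. N) \<Otimes>\<^sub>M N)"
      by measurable
    then show ?thesis
      by (subst nn_integral_indep_next[OF ind])
        (simp_all add: traj Qd[symmetric] split_beta' del: One_nat_def)
  qed
  also have "\<dots> = (\<integral>\<^sup>+ \<omega>. W (?Z k \<omega>) * survival Q step C (Suc n) (?T \<omega> k) \<partial>M)"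
  proof (rule nn_integral_cong)
    fix \<omega> assume \<omega>: "\<omega> \<in> space M"
    have "?Z k \<omega> \<in> space (Pi\<^sub>M {1..k} (\<lambda>_. N))"
      using \<omega> measurable_space[OF X] by (auto simp: space_PiM)
    then have [measurable]: "?T \<omega> k \<in> space S"
      using measurable_space[OF tr[OF order_refl]] traj[OF order_refl] by metis
    show "(\<integral>\<^sup>+ x. W (?Z k \<omega>) * (indicator C (step (?T \<omega> k) x) *
        survival Q step C n (step (?T \<omega> k) x)) \<partial>Q) = W (?Z k \<omega>) * survival Q step C (Suc n) (?T \<omega> k)"
      unfolding survival.simps by (rule nn_integral_cmult) measurable
  qed
  finally show ?case .
qed


text \<open>\<open>F\<close> may be strictly coarser than the past observations, as censoring loses
  information. \<open>F_past\<close> turns each test event into a weight on past observations, and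
  \<open>adapted\<close> makes the candidate \<open>F\<close>-measurable; together these
  characterize the conditional expectation.\<close>

lemma (in prob_space) nn_cond_exp_survival:
  assumes ind: "indep_vars (\<lambda>_. N) X {1::nat..}"
    and Q: "\<And>j. k < j \<Longrightarrow> distr M N (X j) = Q"
    and step[measurable]: "case_prod step \<in> measurable (S \<Otimes>\<^sub>M N) S"
    and C[measurable]: "C \<in> sets S" and s: "s \<in> space S"
    and F: "subalgebra M F"
    and F_past: "\<And>A. A \<in> sets F \<Longrightarrow>
      \<exists>B\<in>sets (Pi\<^sub>M {1..k} (\<lambda>_. N)). A = (\<lambda>\<omega>. \<lambda>i\<in>{1..k}. X i \<omega>) -` B \<inter> space M"
    and adapted: "\<And>i. i \<le> k \<Longrightarrow> (\<lambda>\<omega>. trajectory step s (\<lambda>i. X i \<omega>) i) \<in> measurable F S"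
  shows "AE \<omega> in M. of_bool (\<forall>i\<in>{1..k}. trajectory step s (\<lambda>i. X i \<omega>) i \<in> C) *
      (\<Sum>n. survival Q step C n (trajectory step s (\<lambda>i. X i \<omega>) k)) =
    nn_cond_exp M F
      (\<lambda>\<omega>. \<Sum>n. of_bool (\<forall>i\<in>{1..k + n}. trajectory step s (\<lambda>i. X i \<omega>) i \<in> C)) \<omega>"
proof -
  let ?T = "\<lambda>\<omega>. trajectory step s (\<lambda>i. X i \<omega>)" and ?Z = "\<lambda>m \<omega>. \<lambda>i\<in>{1..m}. X i \<omega>"
  interpret finite_measure_subalgebra M F
    by unfold_locales (rule F)
  have X[measurable]: "X i \<in> measurable M N" if "1 \<le> i" for i
    using ind that by (auto simp: indep_vars_def)
  have Qd: "Q = distr M N (X (Suc k))" using Q by simp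
  interpret Q: prob_space Q unfolding Qd by (rule prob_space_distr) simp
  have [measurable_cong]: "sets Q = sets N" by (simp add: Qd)
  have surv[measurable]: "survival Q step C n \<in> borel_measurable S" for n
    by (intro measurable_survival Q.sigma_finite_measure_axioms) measurable
  have tr[measurable]: "(\<lambda>z. trajectory step s z j) \<in> measurable (Pi\<^sub>M {1..m} (\<lambda>_. N)) S" if "j \<le> m" for j m
    by (intro measurable_trajectory step s that)
  have traj: "trajectory step s (?Z m \<omega>) j = ?T \<omega> j" if "j \<le> m" for j m \<omega>
    using that by (intro trajectory_cong) auto
  have Z[measurable]: "?Z m \<in> measurable M (Pi\<^sub>M {1..m} (\<lambda>_. N))" for m
    by (rule measurable_restrict) auto
  have T[measurable]: "(\<lambda>\<omega>. ?T \<omega> j) \<in> measurable M S" for j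
    using measurable_compose[OF Z tr[OF order_refl]] by (simp add: traj del: One_nat_def)
  note adapted[measurable]
  show ?thesis
  proof (rule nn_cond_exp_charact)
    fix A assume "A \<in> sets F"
    then obtain B where B[measurable]: "B \<in> sets (Pi\<^sub>M {1..k} (\<lambda>_. N))"
      and A: "A = ?Z k -` B \<inter> space M"
      using F_past by blast
    \<comment> \<open>The weight carries both the test event and survival up to time
      \<open>k\<close>, leaving only the times after \<open>k\<close> to
      \<open>nn_integral_survival\<close>.\<close>
    let ?W = "\<lambda>z. indicator B z * of_bool (\<forall>i\<in>{1..k}. trajectory step s z i \<in> C) :: ennreal"
    have W: "?W \<in> borel_measurable (Pi\<^sub>M {1..k} (\<lambda>_. N))"
      by measurable
    have A_meas[measurable]: "A \<in> sets M" unfolding A by measurable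
    have "(\<integral>\<^sup>+ \<omega>\<in>A. (\<Sum>n. of_bool (\<forall>i\<in>{1..k + n}. ?T \<omega> i \<in> C)) \<partial>M) =
        (\<integral>\<^sup>+ \<omega>. (\<Sum>n. ?W (?Z k \<omega>) * of_bool (\<forall>i\<in>{k<..k + n}. ?T \<omega> i \<in> C)) \<partial>M)"
    proof (rule nn_integral_cong)
      fix \<omega> assume "\<omega> \<in> space M"
      have "{1..k + n} = {1..k} \<union> {k<..k + n}" for n by auto
      then have "of_bool (\<forall>i\<in>{1..k + n}. ?T \<omega> i \<in> C) * indicator A \<omega> =
          ?W (?Z k \<omega>) * of_bool (\<forall>i\<in>{k<..k + n}. ?T \<omega> i \<in> C)" for n
        using \<open>\<omega> \<in> space M\<close> unfolding A
        by (auto simp: traj indicator_def simp del: One_nat_def)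
      then show "(\<Sum>n. of_bool (\<forall>i\<in>{1..k + n}. ?T \<omega> i \<in> C)) * indicator A \<omega> =
          (\<Sum>n. ?W (?Z k \<omega>) * of_bool (\<forall>i\<in>{k<..k + n}. ?T \<omega> i \<in> C))"
        by (simp only: ennreal_suminf_multc[symmetric])
    qed
    also have "\<dots> = (\<Sum>n. \<integral>\<^sup>+ \<omega>. ?W (?Z k \<omega>) * of_bool (\<forall>i\<in>{k<..k + n}. ?T \<omega> i \<in> C) \<partial>M)"
      by (rule nn_integral_suminf) (use measurable_compose[OF Z W] in measurable)
    also have "\<dots> = (\<Sum>n. \<integral>\<^sup>+ \<omega>. ?W (?Z k \<omega>) * survival Q step C n (?T \<omega> k) \<partial>M)"
      by (intro suminf_cong nn_integral_survival[OF ind Q step C s W])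
    also have "\<dots> = (\<integral>\<^sup>+ \<omega>. (\<Sum>n. ?W (?Z k \<omega>) * survival Q step C n (?T \<omega> k)) \<partial>M)"
      by (rule nn_integral_suminf[symmetric]) (use measurable_compose[OF Z W] in measurable)
    also have "\<dots> = (\<integral>\<^sup>+ \<omega>\<in>A. (of_bool (\<forall>i\<in>{1..k}. ?T \<omega> i \<in> C) *
        (\<Sum>n. survival Q step C n (?T \<omega> k))) \<partial>M)"
      by (intro nn_integral_cong)
        (auto simp: A traj indicator_def simp del: One_nat_def)
    finally show "(\<integral>\<^sup>+ \<omega>\<in>A. (\<Sum>n. of_bool (\<forall>i\<in>{1..k + n}. ?T \<omega> i \<in> C)) \<partial>M) =
      (\<integral>\<^sup>+ \<omega>\<in>A. (of_bool (\<forall>i\<in>{1..k}. ?T \<omega> i \<in> C) * (\<Sum>n. survival Q step C n (?T \<omega> k))) \<partial>M)" .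
  qed measurable
qed

text \<open>By \<open>lower\<close>, no trajectory from \<open>s\<close> falls below
  \<open>s\<close>, so antimonotonicity bounds the conditional delay by its value at
  \<open>s\<close>. By \<open>stay\<close>, the trajectory rests at \<open>s\<close> up to time
  \<open>k\<close> on a non-null event, where the bound is attained.\<close>

lemma (in prob_space) esssup_nn_cond_exp_survival:
  fixes step :: "real \<Rightarrow> 'b \<Rightarrow> real"
  assumes ind: "indep_vars (\<lambda>_. N) X {1::nat..}"
    and Q: "\<And>j. k < j \<Longrightarrow> distr M N (X j) = Q"
    and step[measurable]: "case_prod step \<in> borel_measurable (borel \<Otimes>\<^sub>M N)"
    and F: "subalgebra M F"
    and F_past: "\<And>A. A \<in> sets F \<Longrightarrow>
      \<exists>B\<in>sets (Pi\<^sub>M {1..k} (\<lambda>_. N)). A = (\<lambda>\<omega>. \<lambda>i\<in>{1..k}. X i \<omega>) -` B \<inter> space M"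
    and adapted: "\<And>i. i \<le> k \<Longrightarrow> (\<lambda>\<omega>. trajectory step s (\<lambda>i. X i \<omega>) i) \<in> borel_measurable F"
    and mono: "\<And>t u x. t \<le> u \<Longrightarrow> u < b \<or> b \<le> t \<Longrightarrow> step t x \<le> step u x"
    and below: "\<And>t x. t < b \<Longrightarrow> step t x \<le> b" and "b < a" and "s < a"
    and lower: "\<And>t x. s \<le> t \<Longrightarrow> s \<le> step t x"
    and stay: "0 < emeasure M {\<omega> \<in> space M. \<forall>i\<in>{1..k}. step s (X i \<omega>) = s}"
  shows "esssup M (nn_cond_exp M F
      (\<lambda>\<omega>. \<Sum>n. of_bool (\<forall>i\<in>{1..k + n}. trajectory step s (\<lambda>i. X i \<omega>) i < a))) =
    (\<Sum>n. survival Q step {..<a} n s)"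
    (is "esssup M ?E = ?c")
proof -
  let ?T = "\<lambda>\<omega>. trajectory step s (\<lambda>i. X i \<omega>)"
  let ?A = "{\<omega> \<in> space M. \<forall>i\<in>{1..k}. step s (X i \<omega>) = s}"
  have X[measurable]: "X i \<in> measurable M N" if "1 \<le> i" for i
    using ind that by (auto simp: indep_vars_def)
  have Qd: "Q = distr M N (X (Suc k))" using Q by simp
  interpret Q: prob_space Q unfolding Qd by (rule prob_space_distr) simp
  have *: "AE \<omega> in M. of_bool (\<forall>i\<in>{1..k}. ?T \<omega> i < a) * (\<Sum>n. survival Q step {..<a} n (?T \<omega> k)) = ?E \<omega>"
    using nn_cond_exp_survival[OF ind Q step _ _ F F_past adapted, where C = "{..<a}"]
    by (simp del: One_nat_def)
  have ge: "s \<le> ?T \<omega> j" for \<omega> j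
    using lower by (induction j) auto
  have E[measurable]: "?E \<in> borel_measurable M"
    by (rule borel_measurable_nn_cond_exp2)
  show ?thesis
  proof (rule antisym)
    show "esssup M ?E \<le> ?c"
    proof (rule esssup_I[OF E])
      show "AE \<omega> in M. ?E \<omega> \<le> ?c"
        using *
      proof eventually_elim
        case (elim \<omega>)
        have "?E \<omega> \<le> (\<Sum>n. survival Q step {..<a} n (?T \<omega> k))"
          unfolding elim[symmetric] by (auto simp: of_bool_def)
        also have "\<dots> \<le> ?c"
          by (intro suminf_le antimonoD[OF Q.survival_antimono[OF mono below \<open>b < a\<close>]] ge) auto
        finally show ?case .
      qed
    qed
    show "?c \<le> esssup M ?E"
    proof (rule ccontr)
      assume less: "\<not> ?c \<le> esssup M ?E"
      \<comment> \<open>On \<open>?A\<close> the conditional expectation equals \<open>?c\<close>: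
        all past states are \<open>s < a\<close>, so the indicator of past survival is 1. An
        essential supremum below \<open>?c\<close> would therefore make \<open>?A\<close>
        null.\<close>
      have "AE \<omega> in M. \<omega> \<notin> ?A"
        using * esssup_AE[of ?E M]
      proof eventually_elim
        case (elim \<omega>)
        show ?case
        proof
          assume A: "\<omega> \<in> ?A"
          have T: "?T \<omega> i = s" if "i \<le> k" for i
            using that
          proof (induction i)
            case (Suc i)
            then show ?case using A by (auto simp: Ball_def)
          qed simp
          have "?c = ?E \<omega>"
            using elim(1) \<open>s < a\<close> by (auto simp: T)
          with elim(2) less show False by simp
        qed
      qed
      moreover have "?A \<in> sets M"
      proof -
        have "(\<lambda>\<omega>. case_prod step (s, X i \<omega>)) \<in> borel_measurable M" if "i \<in> {1..k}" for i
          using that by (intro measurable_compose[OF _ step] measurable_Pair X) auto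
        then show ?thesis
          by (intro sets.sets_Collect_finite_All) (auto intro!: measurable_sets_borel)
      qed
      ultimately have "emeasure M ?A = 0"
        by (subst (asm) AE_iff_null) (auto simp: null_sets_def)
      with stay show False by simp
    qed
  qed
qed

section \<open>Tail-sum form of the delay; sign of the log-likelihood ratio\<close>

text \<open>The positive part of T - m + 1 counts the \<open>n\<close> with m + n \<le> T; the count
  is infinite exactly when \<open>T\<close> is.\<close>

lemma delay_eq_suminf:
  "e2ennreal (max 0 (ereal_of_enat T - ereal (real m) + 1)) = (\<Sum>n. of_bool (enat (m + n) \<le> T))"
proof (cases T)
  case (enat t)
  \<comment> \<open>The truncated difference \<open>Suc t - m\<close> is 0 when \<open>m\<close>
    exceeds \<open>t\<close>, which matches the positive part.\<close>
  have "(\<Sum>n. of_bool (enat (m + n) \<le> T) :: ennreal) = (\<Sum>n<Suc t - m. of_bool (m + n \<le> t))"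
    unfolding enat by (subst suminf_finite[of "{..<Suc t - m}"]) auto
  also have "\<dots> = (\<Sum>n<Suc t - m. 1)"
    by (rule sum.cong) auto
  also have "\<dots> = ennreal (max 0 (real t - real m + 1))"
    by (cases "m \<le> Suc t") (auto simp: ennreal_of_nat_eq_real_of_nat max_def of_nat_diff simp del: ennreal_plus)
  finally show ?thesis
    by (simp add: enat one_ereal_def zero_ereal_def flip: ereal_max)
next
  case infinity
  have "(\<Sum>n. 1 :: ennreal) = top"
    by (simp add: suminf_eq_SUP ennreal_SUP_of_nat_eq_top)
  then show ?thesis by (simp add: infinity)
qed

lemma enat_le_Inf_hitting:
  "enat m \<le> Inf {enat k | k. 1 \<le> k \<and> P k} \<longleftrightarrow> (\<forall>k. 1 \<le> k \<and> k < m \<longrightarrow> \<not> P k)"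
  by (auto simp: le_Inf_iff)

text \<open>Otherwise \<open>f1 > f0\<close> almost surely where \<open>\<psi>\<close> transmits, and \<open>p1 > p0\<close> unless \<open>p0 = 0\<close>, so
  the total mass of \<open>f1\<close> would exceed that of \<open>f0\<close>.\<close>

lemma llr_nonpos_pos_mass:
  assumes f0: "prob_density f0" and f1: "prob_density f1" and \<psi>[measurable]: "Measurable.pred borel \<psi>"
    and p0: "p0 = (\<integral>x. f0 x * indicator {x. \<not> \<psi> x} x \<partial>lborel)"
    and p1: "p1 = (\<integral>x. f1 x * indicator {x. \<not> \<psi> x} x \<partial>lborel)"
  shows "\<not> (AE x in lborel. f0 x \<noteq> 0 \<longrightarrow> 0 < (if \<psi> x then ln (f1 x / f0 x) else ln (p1 / p0)))"
proof
  assume *: "AE x in lborel. f0 x \<noteq> 0 \<longrightarrow> 0 < (if \<psi> x then ln (f1 x / f0 x) else ln (p1 / p0))"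
  have [measurable]: "f0 \<in> borel_measurable borel" "f1 \<in> borel_measurable borel"
    and nn[simp]: "0 \<le> f0 x" "0 \<le> f1 x" for x
    using f0 f1 by (auto simp: prob_density_def)
  have int: "integrable lborel f0" "integrable lborel f1" "integral\<^sup>L lborel f0 = 1" "integral\<^sup>L lborel f1 = 1"
    using f0 f1 by (auto simp: prob_density_def integral_eq_nn_integral intro!: integrableI_nonneg)
  \<comment> \<open>The excess of \<open>f1\<close> over \<open>f0\<close> on the transmission
    region. Both densities have total mass 1, so its integral is \<open>p0 - p1\<close>.\<close>
  define h where "h x = (f1 x - f0 x) * indicator {x. \<psi> x} x" for x
  have split: "(\<integral>x. f x * indicator {x. \<psi> x} x \<partial>lborel) = integral\<^sup>L lborel f - (\<integral>x. f x * indicator {x. \<not> \<psi> x} x \<partial>lborel)"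
    if "integrable lborel f" for f :: "real \<Rightarrow> real"
  proof -
    have "(\<integral>x. f x * indicator {x. \<psi> x} x \<partial>lborel) = (\<integral>x. f x - f x * indicator {x. \<not> \<psi> x} x \<partial>lborel)"
      by (rule Bochner_Integration.integral_cong) (auto simp: indicator_def)
    also have "\<dots> = integral\<^sup>L lborel f - (\<integral>x. f x * indicator {x. \<not> \<psi> x} x \<partial>lborel)"
      by (intro Bochner_Integration.integral_diff that integrable_real_mult_indicator) simp
    finally show ?thesis .
  qed
  have int_h: "integrable lborel h"
    unfolding h_def by (intro integrable_real_mult_indicator Bochner_Integration.integrable_diff int) simp
  have "integral\<^sup>L lborel h = (\<integral>x. f1 x * indicator {x. \<psi> x} x - f0 x * indicator {x. \<psi> x} x \<partial>lborel)"
    by (rule Bochner_Integration.integral_cong) (auto simp: h_def algebra_simps)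
  also have "\<dots> = p0 - p1"
    by (subst Bochner_Integration.integral_diff)
      (auto intro!: integrable_real_mult_indicator int simp: split int p0 p1)
  finally have h: "integral\<^sup>L lborel h = p0 - p1" .
  have p_nn: "0 \<le> p0" "0 \<le> p1"
    unfolding p0 p1 by (auto intro!: Bochner_Integration.integral_nonneg)
  \<comment> \<open>The defaults \<open>y / 0 = 0\<close> and \<open>ln 0 = 0\<close> give no
    positive logarithm, so positivity already excludes zero numerators and denominators.\<close>
  have gt1: "x < y" if "0 < ln (y / x)" "0 \<le> x" "0 \<le> y" for x y :: real
  proof -
    have "x \<noteq> 0" "y \<noteq> 0" using that(1) by auto
    with that have "0 < y / x" "0 < x" by auto
    with that(1) have "1 < y / x" by (simp add: ln_gt_zero_iff)
    with \<open>0 < x\<close> show ?thesis by (simp add: field_simps)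
  qed
  have h_nn: "AE x in lborel. 0 \<le> h x"
    using * by eventually_elim (auto simp: h_def indicator_def dest!: gt1 split: if_splits)
  then have "p1 \<le> p0"
    using integral_nonneg_AE[OF h_nn] h by simp
  then have not: "\<not> 0 < ln (p1 / p0)"
    using gt1[of p1 p0] p_nn by auto
  \<comment> \<open>The constant logarithm on the censored region is not positive, so the assumption
    can hold there only where \<open>f0\<close> vanishes.\<close>
  have censored: "AE x in lborel. \<not> \<psi> x \<longrightarrow> f0 x = 0"
    using * by eventually_elim (use not in \<open>auto split: if_splits\<close>)
  then have "p0 = 0"
    unfolding p0 by (intro integral_eq_zero_AE) (auto elim!: eventually_mono simp: indicator_def)
  with h \<open>p1 \<le> p0\<close> p_nn have "integral\<^sup>L lborel h = 0"
    by simp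
  then have "AE x in lborel. h x = 0"
    using integral_nonneg_eq_0_iff_AE[OF int_h h_nn] by simp
  \<comment> \<open>Where \<open>\<psi>\<close> transmits, \<open>h x = 0\<close> means
    \<open>f1 x = f0 x\<close>; if this value were nonzero, the logarithm would be
    \<open>ln 1 = 0\<close>, not positive.\<close>
  with * censored have "AE x in lborel. f0 x = 0"
  proof eventually_elim
    case (elim x)
    then show ?case
      by (cases "\<psi> x") (auto simp: h_def)
  qed
  then have "integral\<^sup>L lborel f0 = 0"
    by (rule integral_eq_zero_AE)
  with int show False by simp
qed

section \<open>The CuSum-AC recursion on messages and on observations\<close>

text \<open>The update reads only the message that reaches the receiver. This version shows that the
  statistic is determined by the information; \<open>cusum_step\<close> is the same update fed with
  the raw observation.\<close>

definition cusum_update :: "(enat \<Rightarrow> 'w measure) \<Rightarrow> (nat \<Rightarrow> 'w \<Rightarrow> real) \<Rightarrow> (real \<Rightarrow> real) \<Rightarrow>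
    (real \<Rightarrow> real) \<Rightarrow> (real \<Rightarrow> strategy) \<Rightarrow> real \<Rightarrow> real \<Rightarrow> real \<Rightarrow> bool \<times> real \<Rightarrow> real" where
  "cusum_update P X f\<^sub>0 f\<^sub>1 \<psi>s a\<^sub>1 \<epsilon>\<^sub>1 s m =
     (let s' = max 0 (s + llr P X f\<^sub>0 f\<^sub>1 (cusum_ac_strategy \<psi>s a\<^sub>1 \<epsilon>\<^sub>1 s) (fst m) (snd m))
      in if s < a\<^sub>1 \<and> s' \<ge> a\<^sub>1 then a\<^sub>1 else s')"

definition message :: "strategy \<Rightarrow> real \<Rightarrow> bool \<times> real" where
  "message \<psi> x = (\<psi> x, of_bool (\<psi> x) * x)"

definition cusum_step :: "(enat \<Rightarrow> 'w measure) \<Rightarrow> (nat \<Rightarrow> 'w \<Rightarrow> real) \<Rightarrow> (real \<Rightarrow> real) \<Rightarrow>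
    (real \<Rightarrow> real) \<Rightarrow> (real \<Rightarrow> strategy) \<Rightarrow> real \<Rightarrow> real \<Rightarrow> real \<Rightarrow> real \<Rightarrow> real" where
  "cusum_step P X f\<^sub>0 f\<^sub>1 \<psi>s a\<^sub>1 \<epsilon>\<^sub>1 s x =
     cusum_update P X f\<^sub>0 f\<^sub>1 \<psi>s a\<^sub>1 \<epsilon>\<^sub>1 s (message (cusum_ac_strategy \<psi>s a\<^sub>1 \<epsilon>\<^sub>1 s) x)"

text \<open>The observation enters \<open>llr\<close> only in a term with factor
  \<open>\<gamma>\<close>, so masking a censored value by 0 changes nothing.\<close>

lemma llr_message: "llr P X f\<^sub>0 f\<^sub>1 \<psi> (fst (message \<psi> x)) (snd (message \<psi> x)) = llr P X f\<^sub>0 f\<^sub>1 \<psi> (\<psi> x) x"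
  by (simp add: llr_def message_def)

text \<open>States on the same side of \<open>a\<^sub>1\<close> use the same strategy and so receive
  the same increment; adding it, truncating at 0 and capping at \<open>a\<^sub>1\<close> all
  preserve order.\<close>

lemma cusum_step_mono:
  assumes "s \<le> t" "t < a\<^sub>1 \<or> a\<^sub>1 \<le> s"
  shows "cusum_step P X f\<^sub>0 f\<^sub>1 \<psi>s a\<^sub>1 \<epsilon>\<^sub>1 s x \<le> cusum_step P X f\<^sub>0 f\<^sub>1 \<psi>s a\<^sub>1 \<epsilon>\<^sub>1 t x"
  using assms
  by (auto simp: cusum_step_def cusum_update_def llr_message Let_def cusum_ac_strategy_def)

lemma cusum_step_below: "s < a\<^sub>1 \<Longrightarrow> cusum_step P X f\<^sub>0 f\<^sub>1 \<psi>s a\<^sub>1 \<epsilon>\<^sub>1 s x \<le> a\<^sub>1"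
  by (auto simp: cusum_step_def cusum_update_def Let_def)


text \<open>The cap returns \<open>a\<^sub>1\<close> only when \<open>s < a\<^sub>1\<close>, and
  then \<open>a\<^sub>1\<close> is positive because \<open>s\<close> is nonnegative.\<close>

lemma cusum_step_nonneg: "0 \<le> s \<Longrightarrow> 0 \<le> cusum_step P X f\<^sub>0 f\<^sub>1 \<psi>s a\<^sub>1 \<epsilon>\<^sub>1 s x"
  by (auto simp: cusum_step_def cusum_update_def Let_def)

lemma cusum_ac_stat_eq_trajectory_step:
  "cusum_ac_stat P X f\<^sub>0 f\<^sub>1 \<psi>s a\<^sub>1 \<epsilon>\<^sub>1 k \<omega> =
     trajectory (cusum_step P X f\<^sub>0 f\<^sub>1 \<psi>s a\<^sub>1 \<epsilon>\<^sub>1) 0 (\<lambda>i. X i \<omega>) k"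
  by (induction k) (simp_all add: cusum_step_def cusum_update_def llr_message Let_def)

lemma info_cusum_ac:
  assumes "i \<in> {1..k}"
  shows "info X (cusum_ac_policy P X f\<^sub>0 f\<^sub>1 \<psi>s a\<^sub>1 \<epsilon>\<^sub>1) k \<omega> i =
    message (cusum_ac_strategy \<psi>s a\<^sub>1 \<epsilon>\<^sub>1
      (trajectory (cusum_step P X f\<^sub>0 f\<^sub>1 \<psi>s a\<^sub>1 \<epsilon>\<^sub>1) 0 (\<lambda>i. X i \<omega>) (i - 1))) (X i \<omega>)"
  using assms
  by (simp add: info_def transmitted_def cusum_ac_policy_def message_def cusum_ac_stat_eq_trajectory_step)

text \<open>The source of adaptedness: the right-hand side is a function of the information up to
  time \<open>k\<close>. In the induction, the state at \<open>j\<close> fixes the strategy at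
  \<open>Suc j\<close> and hence the meaning of the next message.\<close>

lemma trajectory_step_eq_trajectory_update:
  assumes "j \<le> k"
  shows "trajectory (cusum_step P X f\<^sub>0 f\<^sub>1 \<psi>s a\<^sub>1 \<epsilon>\<^sub>1) 0 (\<lambda>i. X i \<omega>) j =
    trajectory (cusum_update P X f\<^sub>0 f\<^sub>1 \<psi>s a\<^sub>1 \<epsilon>\<^sub>1) 0
      (info X (cusum_ac_policy P X f\<^sub>0 f\<^sub>1 \<psi>s a\<^sub>1 \<epsilon>\<^sub>1) k \<omega>) j"
  using assms
proof (induction j)
  case (Suc j)
  then show ?case by (simp add: info_cusum_ac) (simp add: cusum_step_def)
qed simp

section \<open>Measurability of the recursion\<close>

context
  fixes f\<^sub>0 f\<^sub>1 :: "real \<Rightarrow> real" and \<psi>s :: "real \<Rightarrow> strategy" and \<epsilon>\<^sub>1 :: real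
  assumes [measurable]: "f\<^sub>0 \<in> borel_measurable borel" "f\<^sub>1 \<in> borel_measurable borel"
    "Measurable.pred borel (\<psi>s 1)" "Measurable.pred borel (\<psi>s \<epsilon>\<^sub>1)"
begin

lemma measurable_message:
  "(\<lambda>(s, x). message (cusum_ac_strategy \<psi>s a\<^sub>1 \<epsilon>\<^sub>1 s) x)
    \<in> measurable (borel \<Otimes>\<^sub>M borel) (count_space UNIV \<Otimes>\<^sub>M borel)"
proof -
  \<comment> \<open>Splitting on the threshold leaves only the strategies \<open>\<psi>s 1\<close>
    and \<open>\<psi>s \<epsilon>\<^sub>1\<close>; nothing is known about measurability of
    \<open>\<psi>s\<close> in its rate argument.\<close>
  have eq: "(\<lambda>(s, x). message (cusum_ac_strategy \<psi>s a\<^sub>1 \<epsilon>\<^sub>1 s) x) =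
      (\<lambda>p. if a\<^sub>1 \<le> fst p then (\<psi>s 1 (snd p), if \<psi>s 1 (snd p) then snd p else 0)
           else (\<psi>s \<epsilon>\<^sub>1 (snd p), if \<psi>s \<epsilon>\<^sub>1 (snd p) then snd p else 0))"
    by (auto simp: message_def cusum_ac_strategy_def fun_eq_iff)
  show ?thesis unfolding eq by measurable
qed

lemma measurable_cusum_update:
  "case_prod (cusum_update P X f\<^sub>0 f\<^sub>1 \<psi>s a\<^sub>1 \<epsilon>\<^sub>1)
    \<in> borel_measurable (borel \<Otimes>\<^sub>M (count_space UNIV \<Otimes>\<^sub>M borel))"
proof -
  define c where "c \<psi> = ln (\<P>(\<omega> in P 1. \<not> \<psi> (X 1 \<omega>)) / \<P>(\<omega> in P \<infinity>. \<not> \<psi> (X 1 \<omega>)))" for \<psi>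
  define g where "g p = max 0 (fst p + (if fst (snd p) then ln (f\<^sub>1 (snd (snd p)) / f\<^sub>0 (snd (snd p)))
      else if a\<^sub>1 \<le> fst p then c (\<psi>s 1) else c (\<psi>s \<epsilon>\<^sub>1)))" for p :: "real \<times> bool \<times> real"
  have eq: "case_prod (cusum_update P X f\<^sub>0 f\<^sub>1 \<psi>s a\<^sub>1 \<epsilon>\<^sub>1) =
      (\<lambda>p. if fst p < a\<^sub>1 \<and> g p \<ge> a\<^sub>1 then a\<^sub>1 else g p)"
    by (auto simp: cusum_update_def g_def c_def cusum_ac_strategy_def llr_def Let_def fun_eq_iff)
  have [measurable]: "g \<in> borel_measurable (borel \<Otimes>\<^sub>M (count_space UNIV \<Otimes>\<^sub>M borel))"
    unfolding g_def by measurable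
  show ?thesis unfolding eq by measurable
qed

lemma measurable_cusum_step:
  "case_prod (cusum_step P X f\<^sub>0 f\<^sub>1 \<psi>s a\<^sub>1 \<epsilon>\<^sub>1) \<in> borel_measurable (borel \<Otimes>\<^sub>M borel)"
proof -
  have "(\<lambda>p. (fst p, case_prod (\<lambda>s x. message (cusum_ac_strategy \<psi>s a\<^sub>1 \<epsilon>\<^sub>1 s) x) p))
      \<in> measurable (borel \<Otimes>\<^sub>M borel) (borel \<Otimes>\<^sub>M (count_space UNIV \<Otimes>\<^sub>M borel))"
    using measurable_message by measurable
  from measurable_compose[OF this measurable_cusum_update]
  show ?thesis by (simp add: cusum_step_def case_prod_beta')
qed

end

section \<open>The worst-case delay for a fixed change point\<close>

lemma worst_delay_cusum_ac:
  assumes f\<^sub>0: "prob_density f\<^sub>0" and f\<^sub>1: "prob_density f\<^sub>1"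
    and model: "change_point_model P X f\<^sub>0 f\<^sub>1"
    and \<psi>1: "\<psi>s 1 = (\<lambda>_. True)" and \<psi>[measurable]: "Measurable.pred borel (\<psi>s \<epsilon>\<^sub>1)"
    and "0 < a" "a\<^sub>1 < a" "1 \<le> \<nu>"
  shows "worst_delay P X (cusum_ac_time P X f\<^sub>0 f\<^sub>1 \<psi>s a a\<^sub>1 \<epsilon>\<^sub>1) (cusum_ac_policy P X f\<^sub>0 f\<^sub>1 \<psi>s a\<^sub>1 \<epsilon>\<^sub>1) \<nu> =
    (\<Sum>n. survival (density lborel f\<^sub>1) (cusum_step P X f\<^sub>0 f\<^sub>1 \<psi>s a\<^sub>1 \<epsilon>\<^sub>1) {..<a} n 0)"
proof -
  interpret change_point_model P X f\<^sub>0 f\<^sub>1 by fact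
  let ?k = "\<nu> - 1" and ?\<Psi> = "cusum_ac_policy P X f\<^sub>0 f\<^sub>1 \<psi>s a\<^sub>1 \<epsilon>\<^sub>1"
  let ?step = "cusum_step P X f\<^sub>0 f\<^sub>1 \<psi>s a\<^sub>1 \<epsilon>\<^sub>1"
  let ?F = "info_algebra (P (enat \<nu>)) X ?\<Psi> ?k"
  let ?O = "Pi\<^sub>M {1..?k} (\<lambda>_. count_space UNIV \<Otimes>\<^sub>M borel) :: (nat \<Rightarrow> bool \<times> real) measure"
  let ?S = "Pi\<^sub>M {1..?k} (\<lambda>_. borel) :: (nat \<Rightarrow> real) measure"
  let ?Z = "\<lambda>\<omega>. \<lambda>i\<in>{1..?k}. X i \<omega>"
  have \<nu>: "1 \<le> enat \<nu>" using \<open>1 \<le> \<nu>\<close> by (simp add: one_enat_def)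
  interpret M: prob_space "P (enat \<nu>)" by (rule prob_space_P[OF \<nu>])
  have [measurable]: "f\<^sub>0 \<in> borel_measurable borel" "f\<^sub>1 \<in> borel_measurable borel"
    using f\<^sub>0 f\<^sub>1 by (auto simp: prob_density_def)
  have [measurable]: "Measurable.pred borel (\<psi>s 1)" by (simp add: \<psi>1)
  have step[measurable]: "case_prod ?step \<in> borel_measurable (borel \<Otimes>\<^sub>M borel)"
    by (rule measurable_cusum_step) measurable
  have [measurable]: "?step s \<in> borel_measurable borel" for s
    using measurable_Pair2[OF step, of s] by simp
  have ind: "M.indep_vars (\<lambda>_. borel) X {1..}" by (rule indep_X[OF \<nu>])
  have X[measurable]: "X i \<in> borel_measurable (P (enat \<nu>))" if "1 \<le> i" for i
    using ind that by (auto simp: M.indep_vars_def)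
  have Z: "?Z \<in> measurable (P (enat \<nu>)) ?S"
    by (rule measurable_restrict) auto

  \<comment> \<open>\<open>J\<close> recomputes the information from the uncensored past
    observations, so every event of \<open>?F\<close> is an event of those observations.\<close>
  define J where "J z = (\<lambda>i\<in>{1..?k}. message (cusum_ac_strategy \<psi>s a\<^sub>1 \<epsilon>\<^sub>1 (trajectory ?step 0 z (i - 1))) (z i))" for z
  have J: "J \<in> measurable ?S ?O"
    unfolding J_def
  proof (rule measurable_restrict)
    fix i assume i: "i \<in> {1..?k}"
    have "(\<lambda>z. (trajectory ?step 0 z (i - 1), z i)) \<in> measurable ?S (borel \<Otimes>\<^sub>M borel)"
      by (intro measurable_Pair measurable_trajectory step measurable_component_singleton i)
        (use i in auto)
    from measurable_compose[OF this measurable_message]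
    show "(\<lambda>z. message (cusum_ac_strategy \<psi>s a\<^sub>1 \<epsilon>\<^sub>1 (trajectory ?step 0 z (i - 1))) (z i))
        \<in> measurable ?S (count_space UNIV \<Otimes>\<^sub>M borel)"
      by simp
  qed
  have info_J: "info X ?\<Psi> ?k \<omega> = J (?Z \<omega>)" for \<omega>
  proof
    fix i
    show "info X ?\<Psi> ?k \<omega> i = J (?Z \<omega>) i"
    proof (cases "i \<in> {1..?k}")
      case True
      moreover have "trajectory ?step 0 (?Z \<omega>) (i - 1) = trajectory ?step 0 (\<lambda>i. X i \<omega>) (i - 1)"
        using True by (intro trajectory_cong) auto
      ultimately show ?thesis
        by (simp add: info_cusum_ac J_def del: One_nat_def)
    qed (auto simp: info_def J_def)
  qed
  have info: "info X ?\<Psi> ?k \<in> measurable (P (enat \<nu>)) ?O"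
    using measurable_compose[OF Z J] by (simp add: info_J[abs_def] del: One_nat_def)
  then have info_space: "info X ?\<Psi> ?k \<in> space (P (enat \<nu>)) \<rightarrow> space ?O"
    by (rule measurable_space[THEN funcsetI])
  have F_sets: "sets ?F = {info X ?\<Psi> ?k -` B \<inter> space (P (enat \<nu>)) | B. B \<in> sets ?O}"
    unfolding info_algebra_def by (rule sets_vimage_algebra2[OF info_space])
  have F: "subalgebra (P (enat \<nu>)) ?F"
    unfolding subalgebra_def F_sets using measurable_sets[OF info]
    by (auto simp: info_algebra_def)
  have F_past: "\<exists>B\<in>sets ?S. A = ?Z -` B \<inter> space (P (enat \<nu>))" if A: "A \<in> sets ?F" for A
  proof -
    obtain B where "B \<in> sets ?O" "A = info X ?\<Psi> ?k -` B \<inter> space (P (enat \<nu>))"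
      using A unfolding F_sets by blast
    moreover from this have "A = ?Z -` (J -` B \<inter> space ?S) \<inter> space (P (enat \<nu>))"
      using measurable_space[OF Z] by (auto simp: info_J simp del: One_nat_def)
    ultimately show ?thesis
      using measurable_sets[OF J] by blast
  qed
  have info_F: "info X ?\<Psi> ?k \<in> measurable ?F ?O"
    unfolding info_algebra_def by (rule measurable_vimage_algebra1[OF info_space])
  have adapted: "(\<lambda>\<omega>. trajectory ?step 0 (\<lambda>i. X i \<omega>) i) \<in> borel_measurable ?F" if "i \<le> ?k" for i
    unfolding trajectory_step_eq_trajectory_update[OF that]
    by (intro measurable_compose[OF info_F] measurable_trajectory measurable_cusum_update that) auto

  have distr_before: "distributed (P \<mu>) lborel (X i) (\<lambda>x. ennreal (f\<^sub>0 x))" if "1 \<le> i" "enat i < \<mu>" for i \<mu>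
    using distributed_X[of \<mu> i] that by (cases \<mu>) (auto simp: one_enat_def)
  have distr_after: "distributed (P \<mu>) lborel (X i) (\<lambda>x. ennreal (f\<^sub>1 x))" if "1 \<le> \<mu>" "\<mu> \<le> enat i" "1 \<le> i" for i \<mu>
    using distributed_X[of \<mu> i] that by (simp add: leD)
  have Q: "distr (P (enat \<nu>)) borel (X j) = density lborel f\<^sub>1" if "?k < j" for j
  proof -
    have "distr (P (enat \<nu>)) borel (X j) = distr (P (enat \<nu>)) lborel (X j)"
      by (rule distr_cong) auto
    then show ?thesis
      using distributed_distr_eq_density[OF distr_after[of "enat \<nu>" j]] that \<nu> by auto
  qed

  \<comment> \<open>\<open>llr\<close> refers to the laws \<open>P 1\<close> and
    \<open>P \<infinity>\<close> whatever \<open>\<nu>\<close> is. Expressing its two probabilities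
    by the densities makes \<open>llr_nonpos_pos_mass\<close> applicable.\<close>
  have censor: "\<P>(\<omega> in P 1. \<not> \<phi> (X 1 \<omega>)) = (\<integral>x. f\<^sub>1 x * indicator {x. \<not> \<phi> x} x \<partial>lborel)"
      "\<P>(\<omega> in P \<infinity>. \<not> \<phi> (X 1 \<omega>)) = (\<integral>x. f\<^sub>0 x * indicator {x. \<not> \<phi> x} x \<partial>lborel)"
    if [measurable]: "Measurable.pred borel \<phi>" for \<phi>
  proof -
    have 0: "0 \<le> f\<^sub>0 x" "0 \<le> f\<^sub>1 x" for x
      using f\<^sub>0 f\<^sub>1 by (auto simp: prob_density_def)
    have *: "\<P>(\<omega> in M. \<not> \<phi> (X 1 \<omega>)) = (\<integral>x. f x * indicator {x. \<not> \<phi> x} x \<partial>lborel)"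
      if d: "distributed M lborel (X 1) (\<lambda>x. ennreal (f x))" and "\<And>x. 0 \<le> f x"
      for M :: "'a measure" and f
    proof -
      have "\<P>(\<omega> in M. \<not> \<phi> (X 1 \<omega>)) = (\<integral>\<omega>. indicator {\<omega> \<in> space M. \<not> \<phi> (X 1 \<omega>)} \<omega> \<partial>M)"
        by (simp add: Int_def conj_commute)
      also have "\<dots> = (\<integral>\<omega>. indicator {x. \<not> \<phi> x} (X 1 \<omega>) \<partial>M)"
        by (rule Bochner_Integration.integral_cong) (auto simp: indicator_def)
      also have "\<dots> = (\<integral>x. f x * indicator {x. \<not> \<phi> x} x \<partial>lborel)"
        by (rule distributed_integral[OF d, symmetric]) (use that in auto)
      finally show ?thesis .
    qed
    show "\<P>(\<omega> in P 1. \<not> \<phi> (X 1 \<omega>)) = (\<integral>x. f\<^sub>1 x * indicator {x. \<not> \<phi> x} x \<partial>lborel)"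
      by (rule *[OF distr_after]) (auto simp: one_enat_def 0)
    show "\<P>(\<omega> in P \<infinity>. \<not> \<phi> (X 1 \<omega>)) = (\<integral>x. f\<^sub>0 x * indicator {x. \<not> \<phi> x} x \<partial>lborel)"
      by (rule *[OF distr_before]) (auto simp: 0)
  qed
  let ?B = "{x. ?step 0 x = 0}" and ?\<phi> = "cusum_ac_strategy \<psi>s a\<^sub>1 \<epsilon>\<^sub>1 0"
  have B[measurable]: "?B \<in> sets borel" by measurable
  \<comment> \<open>\<open>?B\<close> collects the observations that keep the statistic at 0. Before
    the change they are drawn from \<open>f\<^sub>0\<close>, so \<open>?B\<close> must have positive
    mass under \<open>f\<^sub>0\<close>.\<close>
  have p: "(\<integral>\<^sup>+ x. ennreal (f\<^sub>0 x) * indicator ?B x \<partial>lborel) \<noteq> 0"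
  proof
    assume "(\<integral>\<^sup>+ x. ennreal (f\<^sub>0 x) * indicator ?B x \<partial>lborel) = 0"
    then have "AE x in lborel. ennreal (f\<^sub>0 x) * indicator ?B x = 0"
      by (subst (asm) nn_integral_0_iff_AE) auto
    then have "AE x in lborel. f\<^sub>0 x \<noteq> 0 \<longrightarrow> 0 < llr P X f\<^sub>0 f\<^sub>1 ?\<phi> (?\<phi> x) x"
    proof eventually_elim
      case (elim x)
      show ?case
      proof
        assume "f\<^sub>0 x \<noteq> 0"
        with f\<^sub>0 have "0 < f\<^sub>0 x" by (auto simp: prob_density_def less_le)
        with elim have "?step 0 x \<noteq> 0" by (auto simp: indicator_def)
        \<comment> \<open>If the ratio were at most 0, truncation would give 0, and the cap could
          not act, since it would need both \<open>0 < a\<^sub>1\<close> and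
          \<open>a\<^sub>1 \<le> 0\<close>.\<close>
        then show "0 < llr P X f\<^sub>0 f\<^sub>1 ?\<phi> (?\<phi> x) x"
          by (auto simp: cusum_step_def cusum_update_def llr_message Let_def max_def split: if_splits)
      qed
    qed
    moreover have \<phi>: "Measurable.pred borel ?\<phi>"
      by (simp add: cusum_ac_strategy_def)
    moreover have "llr P X f\<^sub>0 f\<^sub>1 ?\<phi> (?\<phi> x) x = (if ?\<phi> x then ln (f\<^sub>1 x / f\<^sub>0 x) else
        ln ((\<integral>x. f\<^sub>1 x * indicator {x. \<not> ?\<phi> x} x \<partial>lborel) / (\<integral>x. f\<^sub>0 x * indicator {x. \<not> ?\<phi> x} x \<partial>lborel)))" for x
      unfolding llr_def censor[OF \<phi>] by simp
    ultimately show False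
      using llr_nonpos_pos_mass[OF f\<^sub>0 f\<^sub>1 \<phi> refl refl] by (simp only:)
  qed
  have stay: "0 < emeasure (P (enat \<nu>)) {\<omega> \<in> space (P (enat \<nu>)). \<forall>i\<in>{1..?k}. ?step 0 (X i \<omega>) = 0}"
  \<comment> \<open>With no past observations the event is the whole space; the product formula for
    independent events requires a nonempty index set.\<close>
  proof (cases "?k = 0")
    case True
    then show ?thesis by (simp add: M.emeasure_space_1)
  next
    case False
    have "0 < M.prob (X i -` ?B \<inter> space (P (enat \<nu>)))" if i: "i \<in> {1..?k}" for i
    proof -
      have d: "distributed (P (enat \<nu>)) lborel (X i) (\<lambda>x. ennreal (f\<^sub>0 x))"
        by (rule distr_before) (use i in auto)
      have "emeasure (P (enat \<nu>)) (X i -` ?B \<inter> space (P (enat \<nu>))) \<noteq> 0"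
        using p by (subst distributed_emeasure[OF d]) (auto simp: B)
      then show ?thesis
        unfolding M.emeasure_eq_measure zero_less_measure_iff by (metis ennreal_0)
    qed
    then have "0 < (\<Prod>i\<in>{1..?k}. M.prob (X i -` ?B \<inter> space (P (enat \<nu>))))"
      by (intro prod_pos) blast
    also have "(\<Prod>i\<in>{1..?k}. M.prob (X i -` ?B \<inter> space (P (enat \<nu>)))) =
        M.prob (\<Inter>i\<in>{1..?k}. X i -` ?B \<inter> space (P (enat \<nu>)))"
      by (rule M.indep_varsD[OF ind, symmetric]) (use False in auto)
    also have "(\<Inter>i\<in>{1..?k}. X i -` ?B \<inter> space (P (enat \<nu>))) =
        {\<omega> \<in> space (P (enat \<nu>)). \<forall>i\<in>{1..?k}. ?step 0 (X i \<omega>) = 0}"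
      using False by auto
    finally show ?thesis
      unfolding M.emeasure_eq_measure ennreal_less_zero_iff .
  qed

  have "(\<lambda>\<omega>. e2ennreal (max 0 (ereal_of_enat (cusum_ac_time P X f\<^sub>0 f\<^sub>1 \<psi>s a a\<^sub>1 \<epsilon>\<^sub>1 \<omega>) - ereal (real \<nu>) + 1))) =
    (\<lambda>\<omega>. \<Sum>n. of_bool (\<forall>i\<in>{1..?k + n}. trajectory ?step 0 (\<lambda>i. X i \<omega>) i < a))"
  proof -
    \<comment> \<open>Stopping at \<open>\<nu> + n\<close> or later only forbids crossings up to
      time \<open>\<nu> + n - 1\<close>, which is \<open>?k + n\<close>.\<close>
    have "enat (\<nu> + n) \<le> cusum_ac_time P X f\<^sub>0 f\<^sub>1 \<psi>s a a\<^sub>1 \<epsilon>\<^sub>1 \<omega> \<longleftrightarrow>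
        (\<forall>i\<in>{1..?k + n}. trajectory ?step 0 (\<lambda>i. X i \<omega>) i < a)" for n \<omega>
    proof -
      have "i \<in> {1..?k + n} \<longleftrightarrow> 1 \<le> i \<and> i < \<nu> + n" for i
        using \<open>1 \<le> \<nu>\<close> by auto
      then show ?thesis
        unfolding cusum_ac_time_def enat_le_Inf_hitting cusum_ac_stat_eq_trajectory_step
        by (simp add: Ball_def not_le del: atLeastAtMost_iff)
    qed
    then show ?thesis by (simp only: delay_eq_suminf)
  qed
  then show ?thesis
    unfolding worst_delay_def
    by (simp only:) (rule M.esssup_nn_cond_exp_survival[OF ind Q step F F_past adapted
      cusum_step_mono cusum_step_below \<open>a\<^sub>1 < a\<close> \<open>0 < a\<close> cusum_step_nonneg stay])
qed

theorem theorem1: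
  fixes P :: "enat \<Rightarrow> 'w measure" and X :: "nat \<Rightarrow> 'w \<Rightarrow> real"
    and f\<^sub>0 f\<^sub>1 :: "real \<Rightarrow> real" and \<psi>s :: "real \<Rightarrow> strategy" and a a\<^sub>1 \<epsilon>\<^sub>1 :: real
  defines "T \<equiv> cusum_ac_time P X f\<^sub>0 f\<^sub>1 \<psi>s a a\<^sub>1 \<epsilon>\<^sub>1"
    and "\<Psi> \<equiv> cusum_ac_policy P X f\<^sub>0 f\<^sub>1 \<psi>s a\<^sub>1 \<epsilon>\<^sub>1"
  assumes "prob_density f\<^sub>0" and "prob_density f\<^sub>1"
    and "0 < kl_div f\<^sub>1 f\<^sub>0" and "kl_div f\<^sub>1 f\<^sub>0 < \<infinity>"
    and "0 < kl_div f\<^sub>0 f\<^sub>1" and "kl_div f\<^sub>0 f\<^sub>1 < \<infinity>"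
    and "change_point_model P X f\<^sub>0 f\<^sub>1"
    and "optimal_strategies P X f\<^sub>0 f\<^sub>1 \<psi>s"
    and "a > 0" and "a\<^sub>1 < a" and "0 < \<epsilon>\<^sub>1" and "\<epsilon>\<^sub>1 \<le> 1"
  shows "\<forall>\<nu>\<ge>1. lorden_delay P X T \<Psi> = worst_delay P X T \<Psi> \<nu>"
proof -
  \<comment> \<open>A maximizer is feasible, and measurability is part of the feasibility condition
    \<open>has_rate\<close>.\<close>
  have "Measurable.pred borel (\<psi>s \<epsilon>\<^sub>1)" "\<psi>s 1 = (\<lambda>_. True)"
    using assms by (auto simp: optimal_strategies_def is_arg_max_def has_rate_def)
  then have const: "worst_delay P X T \<Psi> \<nu> =
      (\<Sum>n. survival (density lborel f\<^sub>1) (cusum_step P X f\<^sub>0 f\<^sub>1 \<psi>s a\<^sub>1 \<epsilon>\<^sub>1) {..<a} n 0)" if "1 \<le> \<nu>" for \<nu>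
    unfolding T_def \<Psi>_def using that assms by (intro worst_delay_cusum_ac)
  have "lorden_delay P X T \<Psi> =
      (\<Sum>n. survival (density lborel f\<^sub>1) (cusum_step P X f\<^sub>0 f\<^sub>1 \<psi>s a\<^sub>1 \<epsilon>\<^sub>1) {..<a} n 0)"
    unfolding lorden_delay_def by (subst SUP_cong[OF refl const]) auto
  then show ?thesis by (simp add: const)
qed

end
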